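(* Let $E$ be a finite set with a total order $\preceq$, and let $\mathcal{C}\subseteq 2^E$ be a clutter (no member of $\mathcal{C}$ contains another member). Then the size of the ZDD $\mathsf{Z}(\mathcal{C})$ with respect to $(E,\preceq)$ is at most the size of the BDD $\mathsf{B}(\mathcal{C})$ with respect to $(E,\preceq)$.
   Context: A decision diagram over $(E,\preceq)$ is a directed acyclic graph with a unique root (indegree $0$), at most two terminal nodes (outdegree $0$), the 0-terminal $\bot$ and the 1-terminal $\top$, and non-terminal nodes $\nu$, each with a label $\ell(\nu)\in E$ and exactly two outgoing arcs, the 0-arc $(\nu,\nu_0)$ and the 1-arc $(\nu,\nu_1)$, with $\ell(\nu)\prec\ell(\nu_0)$ and $\ell(\nu)\prec\ell(\nu_1)$ (terminal labels are regarded as larger than all elements of $E$). A 1-path is a directed path from the root to $\top$. The BDD $\mathsf{B}(\mathcal{S})$ (resp. ZDD $\mathsf{Z}(\mathcal{S})$) of $\mathcal{S}\subseteq 2^E$ is the unique diagram obtained from the complete binary decision tree of $\mathcal{S}$ (internal nodes at depth $j$ labeled by the $(j+1)$-th smallest element of $E$; the leaf reached by taking 1-arcs exactly at the elements of $X$ is $\top$ iff $X\in\mathcal{S}$, else $\bot$) by exhaustively applying: (NS) merge non-terminal nodes having the same label, the same 0-successor and the same 1-successor; and, for BDDs, (B-ND) remove every non-terminal $\nu$ with $\nu_0=\nu_1$, redirecting arcs entering $\nu$ to $\nu_0$; for ZDDs, (Z-ND) remove every non-terminal $\nu$ with $\nu_1=\bot$, redirecting arcs entering $\nu$ to $\nu_0$.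 The size of a BDD/ZDD is its number of non-terminal nodes. *)

theory Defs
  imports Main
begin

definition clutter :: "'a set set \<Rightarrow> bool" where
  "clutter C \<longleftrightarrow> (\<forall>X\<in>C. \<forall>Y\<in>C. X \<subseteq> Y \<longrightarrow> X = Y)"

datatype 'n node = Bot | Top | Inner 'n

text \<open>The fields \<open>lbl\<close>, \<open>lo\<close> and \<open>hi\<close> are meaningful only on \<open>inner\<close>. A terminal counts as a
  node of the diagram only if it is the root or the target of some arc.\<close>

record ('n, 'a) dd =
  root :: "'n node"
  inner :: "'n set"
  lbl :: "'n \<Rightarrow> 'a"
  lo :: "'n \<Rightarrow> 'n node"
  hi :: "'n \<Rightarrow> 'n node"

definition arcs :: "('n, 'a) dd \<Rightarrow> ('n node \<times> 'n node) set" where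
  "arcs D = {(Inner u, lo D u) | u. u \<in> inner D} \<union> {(Inner u, hi D u) | u. u \<in> inner D}"

definition nodes :: "('n, 'a) dd \<Rightarrow> 'n node set" where
  "nodes D = {root D} \<union> Inner ` inner D \<union> Range (arcs D)"

fun label_before :: "('n, 'a::linorder) dd \<Rightarrow> 'n \<Rightarrow> 'n node \<Rightarrow> bool" where
  "label_before D u (Inner w) \<longleftrightarrow> lbl D u < lbl D w"
| "label_before D u Top \<longleftrightarrow> True"
| "label_before D u Bot \<longleftrightarrow> True"

definition decision_diagram :: "'a::linorder set \<Rightarrow> ('n, 'a) dd \<Rightarrow> bool" where
  "decision_diagram E D \<longleftrightarrow>
     finite (inner D) \<and> acyclic (arcs D) \<and> nodes D \<subseteq> {Bot, Top} \<union> Inner ` inner D \<and>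
     {x \<in> nodes D. x \<notin> Range (arcs D)} = {root D} \<and>
     (\<forall>u \<in> inner D. lbl D u \<in> E \<and> label_before D u (lo D u) \<and> label_before D u (hi D u))"

definition dd_size :: "('n, 'a) dd \<Rightarrow> nat" where
  "dd_size D = card (inner D)"

text \<open>In the complete binary decision tree a node is the list of arc choices leading to it from
  the root (\<open>True\<close> for a 1-arc); the leaves are the two terminals.\<close>

definition chosen :: "'a::linorder set \<Rightarrow> bool list \<Rightarrow> 'a set" where
  "chosen E p = {sorted_list_of_set E ! i | i. i < length p \<and> p ! i}"

definition tree_node :: "'a::linorder set \<Rightarrow> 'a set set \<Rightarrow> bool list \<Rightarrow> bool list node" where
  "tree_node E S p =
     (if length p < card E then Inner p else if chosen E p \<in> S then Top else Bot)"

definition decision_tree :: "'a::linorder set \<Rightarrow> 'a set set \<Rightarrow> (bool list, 'a) dd" where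
  "decision_tree E S =
     \<lparr>root = tree_node E S [],
      inner = {p. length p < card E},
      lbl = (\<lambda>p. sorted_list_of_set E ! length p),
      lo = (\<lambda>p. tree_node E S (p @ [False])),
      hi = (\<lambda>p. tree_node E S (p @ [True]))\<rparr>"

definition redirect :: "'n \<Rightarrow> 'n node \<Rightarrow> 'n node \<Rightarrow> 'n node" where
  "redirect v t x = (if x = Inner v then t else x)"

text \<open>If the removed node is the root, its replacement becomes the root.\<close>

definition remove_node :: "'n \<Rightarrow> 'n node \<Rightarrow> ('n, 'a) dd \<Rightarrow> ('n, 'a) dd" where
  "remove_node v t D =
     \<lparr>root = redirect v t (root D),
      inner = inner D - {v},
      lbl = lbl D,
      lo = (\<lambda>u. redirect v t (lo D u)),
      hi = (\<lambda>u. redirect v t (hi D u))\<rparr>"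

inductive ns_step :: "('n, 'a) dd \<Rightarrow> ('n, 'a) dd \<Rightarrow> bool" where
  "\<lbrakk>u \<in> inner D; v \<in> inner D; u \<noteq> v; lbl D u = lbl D v; lo D u = lo D v; hi D u = hi D v\<rbrakk>
    \<Longrightarrow> ns_step D (remove_node v (Inner u) D)"

inductive bnd_step :: "('n, 'a) dd \<Rightarrow> ('n, 'a) dd \<Rightarrow> bool" where
  "\<lbrakk>v \<in> inner D; lo D v = hi D v\<rbrakk> \<Longrightarrow> bnd_step D (remove_node v (lo D v) D)"

inductive znd_step :: "('n, 'a) dd \<Rightarrow> ('n, 'a) dd \<Rightarrow> bool" where
  "\<lbrakk>v \<in> inner D; hi D v = Bot\<rbrakk> \<Longrightarrow> znd_step D (remove_node v (lo D v) D)"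

definition bdd_step :: "('n, 'a) dd \<Rightarrow> ('n, 'a) dd \<Rightarrow> bool" where
  "bdd_step D D' \<longleftrightarrow> ns_step D D' \<or> bnd_step D D'"

definition zdd_step :: "('n, 'a) dd \<Rightarrow> ('n, 'a) dd \<Rightarrow> bool" where
  "zdd_step D D' \<longleftrightarrow> ns_step D D' \<or> znd_step D D'"

definition is_BDD :: "'a::linorder set \<Rightarrow> 'a set set \<Rightarrow> (bool list, 'a) dd \<Rightarrow> bool" where
  "is_BDD E S D \<longleftrightarrow> bdd_step\<^sup>*\<^sup>* (decision_tree E S) D \<and> (\<nexists>D'. bdd_step D D')"

definition is_ZDD :: "'a::linorder set \<Rightarrow> 'a set set \<Rightarrow> (bool list, 'a) dd \<Rightarrow> bool" where
  "is_ZDD E S D \<longleftrightarrow> zdd_step\<^sup>*\<^sup>* (decision_tree E S) D \<and> (\<nexists>D'. zdd_step D D')"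

lemma finite_inner_decision_tree: "finite (inner (decision_tree E S))"
proof -
  have "{p :: bool list. length p < card E} \<subseteq> {p. set p \<subseteq> UNIV \<and> length p \<le> card E}"
    by auto
  then have "finite {p :: bool list. length p < card E}"
    by (rule finite_subset) (rule finite_lists_length_le, rule finite)
  then show ?thesis
    by (simp add: decision_tree_def)
qed

lemma normal_form_exists:
  assumes "finite (inner D)"
    and "\<And>D D'. R D D' \<Longrightarrow> \<exists>v\<in>inner D. inner D' = inner D - {v}"
  shows "\<exists>D'. R\<^sup>*\<^sup>* D D' \<and> (\<nexists>D''. R D' D'')"
  using assms(1)
proof (induction "card (inner D)" arbitrary: D rule: less_induct)
  case less
  show ?case
  proof (cases "\<exists>D1. R D D1")
    case True
    then obtain D1 v where D1: "R D D1" "v \<in> inner D" "inner D1 = inner D - {v}"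
      using assms(2) by blast
    then have "finite (inner D1)" "card (inner D1) < card (inner D)"
      using less.prems by (simp_all add: card_Diff1_less del: card_Diff_insert)
    then obtain D' where "R\<^sup>*\<^sup>* D1 D'" "\<nexists>D''. R D' D''"
      using less.hyps by blast
    then show ?thesis
      using D1(1) converse_rtranclp_into_rtranclp[of R D D1 D'] by blast
  qed auto
qed

lemma BDD_exists: "\<exists>D. is_BDD E S D"
  unfolding is_BDD_def
  by (rule normal_form_exists[OF finite_inner_decision_tree])
     (auto simp: bdd_step_def ns_step.simps bnd_step.simps remove_node_def)

lemma ZDD_exists: "\<exists>D. is_ZDD E S D"
  unfolding is_ZDD_def
  by (rule normal_form_exists[OF finite_inner_decision_tree])
     (auto simp: zdd_step_def ns_step.simps znd_step.simps remove_node_def)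

lemma Range_arcs: "x \<in> Range (arcs D) \<longleftrightarrow> (\<exists>u\<in>inner D. x = lo D u \<or> x = hi D u)"
  by (auto simp: arcs_def)

lemma label_before_trans: "label_before D u (Inner w) \<Longrightarrow> label_before D w x \<Longrightarrow> label_before D u x"
  by (cases x) auto

lemma acyclic_arcs:
  assumes "\<And>u. u \<in> inner D \<Longrightarrow> label_before D u (lo D u) \<and> label_before D u (hi D u)"
  shows "acyclic (arcs D)"
proof -
  have *: "\<exists>u. x = Inner u \<and> label_before D u y" if "(x, y) \<in> (arcs D)\<^sup>+" for x y
    using that
  proof (induction rule: trancl_induct)
    case (base y)
    then show ?case using assms by (auto simp: arcs_def)
  next
    case (step y z)
    then obtain u w where "x = Inner u" "label_before D u y" "y = Inner w" "label_before D w z"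
      using assms by (auto simp: arcs_def)
    then have "label_before D u z" using label_before_trans[of D u w z] by simp
    then show ?case using \<open>x = Inner u\<close> by simp
  qed
  show ?thesis
    unfolding acyclic_def
  proof (intro allI notI)
    fix x assume "(x, x) \<in> (arcs D)\<^sup>+"
    from *[OF this] show False by auto
  qed
qed

lemma decision_diagram_iff:
  "decision_diagram E D \<longleftrightarrow>
     finite (inner D) \<and> root D \<in> {Bot, Top} \<union> Inner ` inner D \<and>
     (\<forall>u\<in>inner D. lo D u \<in> {Bot, Top} \<union> Inner ` inner D \<and> hi D u \<in> {Bot, Top} \<union> Inner ` inner D) \<and>
     root D \<notin> Range (arcs D) \<and>
     (\<forall>u\<in>inner D. Inner u \<noteq> root D \<longrightarrow> Inner u \<in> Range (arcs D)) \<and>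
     (\<forall>u\<in>inner D. lbl D u \<in> E \<and> label_before D u (lo D u) \<and> label_before D u (hi D u))"
  (is "_ \<longleftrightarrow> ?R")
proof
  assume A: "decision_diagram E D"
  have n: "Inner u \<in> nodes D" "lo D u \<in> nodes D" "hi D u \<in> nodes D" if "u \<in> inner D" for u
    using that by (auto simp: nodes_def arcs_def)
  have r: "root D \<in> nodes D" by (simp add: nodes_def)
  have sub: "nodes D \<subseteq> {Bot, Top} \<union> Inner ` inner D"
    and sing: "{x \<in> nodes D. x \<notin> Range (arcs D)} = {root D}"
    and rest: "finite (inner D)"
      "\<forall>u \<in> inner D. lbl D u \<in> E \<and> label_before D u (lo D u) \<and> label_before D u (hi D u)"
    using A unfolding decision_diagram_def by blast+
  have "root D \<notin> Range (arcs D)"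
    using sing by blast
  moreover have "\<forall>u\<in>inner D. Inner u \<noteq> root D \<longrightarrow> Inner u \<in> Range (arcs D)"
    using n(1) sing by blast
  ultimately show ?R using rest n r sub by blast
next
  assume R: ?R
  have "acyclic (arcs D)" using R by (intro acyclic_arcs) blast
  moreover have "nodes D \<subseteq> {Bot, Top} \<union> Inner ` inner D"
    using R unfolding nodes_def arcs_def by blast
  moreover have "{x \<in> nodes D. x \<notin> Range (arcs D)} = {root D}"
    using R unfolding nodes_def by blast
  ultimately show "decision_diagram E D" using R unfolding decision_diagram_def by blast
qed

lemma root_label_least:
  assumes "decision_diagram E D" "x \<in> inner D" "Inner x \<noteq> root D"
  shows "\<exists>r\<in>inner D. root D = Inner r \<and> lbl D r < lbl D x"
  using assms(2,3)
proof (induction "card {y\<in>inner D. lbl D y < lbl D x}" arbitrary: x rule: less_induct)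
  case less
  then have "Inner x \<in> Range (arcs D)"
    using assms(1) by (simp add: decision_diagram_iff)
  then obtain u where u: "u \<in> inner D" "Inner x = lo D u \<or> Inner x = hi D u"
    by (auto simp: Range_arcs)
  moreover have "label_before D u (lo D u)" "label_before D u (hi D u)"
    using assms(1) u(1) by (simp_all add: decision_diagram_iff)
  ultimately have l: "lbl D u < lbl D x" by (metis label_before.simps(1))
  show ?case
  proof (cases "Inner u = root D")
    case True
    then show ?thesis using u(1) l by metis
  next
    case False
    have "{y\<in>inner D. lbl D y < lbl D u} \<subset> {y\<in>inner D. lbl D y < lbl D x}"
      using l u(1) by auto
    moreover have "finite {y\<in>inner D. lbl D y < lbl D x}"
      using assms(1) by (simp add: decision_diagram_iff)
    ultimately have "card {y\<in>inner D. lbl D y < lbl D u} < card {y\<in>inner D. lbl D y < lbl D x}"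
      by (rule psubset_card_mono[rotated])
    from less.hyps[OF this u(1) False] l show ?thesis by (meson less_trans)
  qed
qed

lemma ns_step_decision_diagram:
  assumes D: "decision_diagram E D" and "ns_step D D'"
  shows "decision_diagram E D'"
  using assms(2)
proof cases
  case (1 u v)
  have nr: "Inner u \<noteq> root D" "Inner v \<noteq> root D"
    using root_label_least[OF D 1(2)] root_label_least[OF D 1(3)] 1(4,5)
    by (metis node.inject less_irrefl)+
  have lb: "label_before D' w x \<longleftrightarrow> label_before D w x" for w x
    by (cases x) (auto simp: 1 remove_node_def)
  have Dfin: "finite (inner D')" using D by (simp add: 1 remove_node_def decision_diagram_iff)
  have Droot: "root D' = root D" using nr by (auto simp: 1 remove_node_def redirect_def)
  have Din: "inner D' = inner D - {v}" by (simp add: 1 remove_node_def)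
  have Dlo: "lo D' = (\<lambda>w. redirect v (Inner u) (lo D w))" "hi D' = (\<lambda>w. redirect v (Inner u) (hi D w))"
      "lbl D' = lbl D"
    by (simp_all add: 1 remove_node_def)
  have rt: "root D' \<in> {Bot, Top} \<union> Inner ` inner D'"
    using D nr by (auto simp: Droot Din decision_diagram_iff)
  have ch: "lo D' w \<in> {Bot, Top} \<union> Inner ` inner D' \<and> hi D' w \<in> {Bot, Top} \<union> Inner ` inner D'"
    if "w \<in> inner D'" for w
  proof -
    have "lo D w \<in> {Bot, Top} \<union> Inner ` inner D" "hi D w \<in> {Bot, Top} \<union> Inner ` inner D"
      using D that by (auto simp: Din decision_diagram_iff)
    then show ?thesis using 1(2,4) by (auto simp: Dlo Din redirect_def)
  qed
  have rr: "root D' \<notin> Range (arcs D')"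
    using D nr by (auto simp: Range_arcs Droot Din Dlo redirect_def decision_diagram_iff)
  have ri: "Inner x \<in> Range (arcs D')" if "x \<in> inner D'" "Inner x \<noteq> root D'" for x
  proof -
    have x: "x \<noteq> v" using that by (simp add: Din)
    have "Inner x \<in> Range (arcs D)" using D that by (auto simp: Din Droot decision_diagram_iff)
    then obtain w where w: "w \<in> inner D" "Inner x = lo D w \<or> Inner x = hi D w"
      by (auto simp: Range_arcs)
    then obtain w' where w': "w' \<in> inner D" "w' \<noteq> v" "Inner x = lo D w' \<or> Inner x = hi D w'"
      using 1(2,4,6,7) by (cases "w = v") metis+
    then show ?thesis unfolding Range_arcs using x
      by (intro bexI[of _ w']) (auto simp: Dlo Din redirect_def)
  qed
  have lab: "lbl D' w \<in> E \<and> label_before D' w (lo D' w) \<and> label_before D' w (hi D' w)"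
    if "w \<in> inner D'" for w
  proof -
    have "lbl D w \<in> E" "label_before D w (lo D w)" "label_before D w (hi D w)"
      using D that by (auto simp: Din decision_diagram_iff)
    then show ?thesis using 1(5) by (auto simp: lb Dlo redirect_def)
  qed
  show ?thesis using Dfin rt ch rr ri lab by (simp add: decision_diagram_iff)
qed

lemma nd_step_decision_diagram:
  assumes D: "decision_diagram E D" and v: "v \<in> inner D" "hi D v = lo D v \<or> hi D v = Bot"
    and D': "D' = remove_node v (lo D v) D"
  shows "decision_diagram E D'"
proof -
  let ?t = "lo D v"
  have lb: "label_before D' w x \<longleftrightarrow> label_before D w x" for w x
    by (cases x) (auto simp: D' remove_node_def)
  have Dfin: "finite (inner D')" using D by (simp add: D' remove_node_def decision_diagram_iff)
  have Droot: "root D' = redirect v ?t (root D)" by (simp add: D' remove_node_def)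
  have Din: "inner D' = inner D - {v}" by (simp add: D' remove_node_def)
  have Dlo: "lo D' = (\<lambda>w. redirect v ?t (lo D w))" "hi D' = (\<lambda>w. redirect v ?t (hi D w))"
      "lbl D' = lbl D"
    by (simp_all add: D' remove_node_def)
  have tlab: "label_before D v ?t" using D v(1) by (simp add: decision_diagram_iff)
  then have tv: "?t \<noteq> Inner v" by auto
  have t: "?t \<in> {Bot, Top} \<union> Inner ` inner D'"
  proof -
    have "?t \<in> {Bot, Top} \<union> Inner ` inner D" using D v(1) by (simp add: decision_diagram_iff)
    then show ?thesis using tv by (auto simp: Din)
  qed
  have red: "redirect v ?t x \<in> {Bot, Top} \<union> Inner ` inner D'" if "x \<in> {Bot, Top} \<union> Inner ` inner D" for x
    using that t by (auto simp: redirect_def Din)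
  have rt: "root D' \<in> {Bot, Top} \<union> Inner ` inner D'"
    unfolding Droot using D by (intro red) (simp add: decision_diagram_iff)
  have ch: "lo D' w \<in> {Bot, Top} \<union> Inner ` inner D' \<and> hi D' w \<in> {Bot, Top} \<union> Inner ` inner D'"
    if "w \<in> inner D'" for w
    unfolding Dlo using D that by (intro conjI red) (simp_all add: decision_diagram_iff Din)
  have lab: "lbl D' w \<in> E \<and> label_before D' w (lo D' w) \<and> label_before D' w (hi D' w)"
    if "w \<in> inner D'" for w
  proof -
    have "lbl D w \<in> E" "label_before D w (lo D w)" "label_before D w (hi D w)"
      using D that by (auto simp: Din decision_diagram_iff)
    moreover have "label_before D w (redirect v ?t x)" if "label_before D w x" for x
      using that tlab by (auto simp: redirect_def intro: label_before_trans)
    ultimately show ?thesis by (simp add: lb Dlo)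
  qed
  have pred: "\<exists>w\<in>inner D. Inner x = lo D w \<or> Inner x = hi D w"
    if "x \<in> inner D" "Inner x \<noteq> root D" for x
    using D that by (auto simp: decision_diagram_iff Range_arcs)
  have before: "lbl D w < lbl D x"
    if "w \<in> inner D" "Inner x = lo D w \<or> Inner x = hi D w" for w x
  proof -
    have "label_before D w (lo D w)" "label_before D w (hi D w)"
      using D that(1) by (simp_all add: decision_diagram_iff)
    then show ?thesis using that(2) by (metis label_before.simps(1))
  qed
  have ri: "Inner x \<in> Range (arcs D')" if x: "x \<in> inner D'" "Inner x \<noteq> root D'" for x
  proof -
    have xv: "x \<noteq> v" "x \<in> inner D" "Inner x \<noteq> root D"
      using x by (auto simp: Din Droot redirect_def split: if_splits)
    then obtain w where w: "w \<in> inner D" "Inner x = lo D w \<or> Inner x = hi D w"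
      using pred by blast
    show ?thesis
    proof (cases "w = v")
      case False
      then show ?thesis unfolding Range_arcs using w xv
        by (intro bexI[of _ w]) (auto simp: Dlo Din redirect_def)
    next
      case True
      then have xt: "Inner x = ?t" using w v(2) by auto
      then have "Inner v \<noteq> root D" using x(2) by (auto simp: Droot redirect_def)
      then obtain u where u: "u \<in> inner D" "Inner v = lo D u \<or> Inner v = hi D u"
        using pred v(1) by blast
      then have "u \<noteq> v" using before by blast
      then show ?thesis unfolding Range_arcs using u xt
        by (intro bexI[of _ u]) (auto simp: Dlo Din redirect_def)
    qed
  qed
  have rr: "root D' \<notin> Range (arcs D')"
  proof
    assume "root D' \<in> Range (arcs D')"
    then obtain w where w: "w \<in> inner D" "w \<noteq> v"
        "root D' = redirect v ?t (lo D w) \<or> root D' = redirect v ?t (hi D w)"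
      by (auto simp: Range_arcs Dlo Din)
    have nroot: "root D \<noteq> lo D u" "root D \<noteq> hi D u" if "u \<in> inner D" for u
      using D that by (auto simp: decision_diagram_iff Range_arcs)
    show False
    proof (cases "root D = Inner v")
      case False
      then show False using w nroot[OF w(1)] nroot[OF v(1)]
        by (auto simp: Droot redirect_def split: if_splits)
    next
      case True
      define A where "A = {y \<in> inner D. y \<noteq> v}"
      have "finite A" "A \<noteq> {}" using D w by (auto simp: A_def decision_diagram_iff)
      define m where "m = arg_min_on (lbl D) A"
      have m: "m \<in> A" "\<And>y. y \<in> A \<Longrightarrow> lbl D m \<le> lbl D y"
        using \<open>finite A\<close> \<open>A \<noteq> {}\<close> arg_min_if_finite[of A "lbl D"] by (auto simp: m_def not_less)
      then have "m \<in> inner D" "Inner m \<noteq> root D" using True by (auto simp: A_def)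
      then obtain u where u: "u \<in> inner D" "Inner m = lo D u \<or> Inner m = hi D u"
        using pred by blast
      then have "u \<notin> A" using before m(2) by (meson leD)
      then have "Inner m = ?t" using u v(2) by (auto simp: A_def)
      moreover have "lo D w \<noteq> Inner v" "hi D w \<noteq> Inner v" using nroot[OF w(1)] True by auto
      ultimately have "Inner m = lo D w \<or> Inner m = hi D w"
        using w(3) True by (auto simp: Droot redirect_def)
      then have "lbl D w < lbl D m" using before w(1) by blast
      then show False using m(2)[of w] w by (simp add: A_def leD)
    qed
  qed
  show ?thesis using Dfin rt ch rr ri lab by (simp add: decision_diagram_iff)
qed

lemma decision_diagram_decision_tree: "finite E \<Longrightarrow> decision_diagram E (decision_tree E S)"
proof -
  assume fin: "finite E"
  let ?D = "decision_tree E S"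
  have sl: "sorted_list_of_set E ! i < sorted_list_of_set E ! Suc i" if "Suc i < card E" for i
    using that fin strict_sorted_list_of_set[of E]
    by (simp add: sorted_wrt_nth_less)
  have el: "sorted_list_of_set E ! i \<in> E" if "i < card E" for i
    using that fin nth_mem[of i "sorted_list_of_set E"] by simp
  have ri: "Inner p \<in> Range (arcs ?D)" if "length p < card E" "p \<noteq> []" for p
  proof -
    from that(2) obtain q b where "p = q @ [b]" by (cases p rule: rev_cases) auto
    then show ?thesis unfolding Range_arcs using that(1)
      by (intro bexI[of _ q]; cases b) (auto simp: decision_tree_def tree_node_def)
  qed
  have rr: "root ?D \<notin> Range (arcs ?D)"
    by (auto simp: Range_arcs decision_tree_def tree_node_def split: if_splits)
  have lab: "label_before ?D p (tree_node E S (p @ [b]))" if "length p < card E" for p b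
    using that sl by (auto simp: decision_tree_def tree_node_def)
  show ?thesis
    unfolding decision_diagram_iff
  proof (intro conjI ballI impI)
    show "finite (inner ?D)" by (rule finite_inner_decision_tree)
    show "root ?D \<notin> Range (arcs ?D)" by (rule rr)
    show "root ?D \<in> {Bot, Top} \<union> Inner ` inner ?D"
      by (auto simp: decision_tree_def tree_node_def)
  next
    fix p assume "p \<in> inner ?D"
    then have p: "length p < card E" by (simp add: decision_tree_def)
    show "lo ?D p \<in> {Bot, Top} \<union> Inner ` inner ?D" "hi ?D p \<in> {Bot, Top} \<union> Inner ` inner ?D"
      by (auto simp: decision_tree_def tree_node_def)
    show "lbl ?D p \<in> E" using el p by (simp add: decision_tree_def)
    show "label_before ?D p (lo ?D p)" using lab[OF p, of False] by (simp add: decision_tree_def)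
    show "label_before ?D p (hi ?D p)" using lab[OF p, of True] by (simp add: decision_tree_def)
    assume "Inner p \<noteq> root ?D"
    then have "p \<noteq> []" using p by (auto simp: decision_tree_def tree_node_def)
    then show "Inner p \<in> Range (arcs ?D)" using ri p by blast
  qed
qed

lemma bdd_step_decision_diagram: "decision_diagram E D \<Longrightarrow> bdd_step D D' \<Longrightarrow> decision_diagram E D'"
  unfolding bdd_step_def
  by (erule disjE, erule (1) ns_step_decision_diagram)
     (auto elim!: bnd_step.cases intro: nd_step_decision_diagram)

lemma zdd_step_decision_diagram: "decision_diagram E D \<Longrightarrow> zdd_step D D' \<Longrightarrow> decision_diagram E D'"
  unfolding zdd_step_def
  by (erule disjE, erule (1) ns_step_decision_diagram)
     (auto elim!: znd_step.cases intro: nd_step_decision_diagram)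

lemma BDD_decision_diagram:
  assumes "finite E" "is_BDD E S D"
  shows "decision_diagram E D"
proof -
  have "bdd_step\<^sup>*\<^sup>* (decision_tree E S) D" using assms(2) by (simp add: is_BDD_def)
  then show ?thesis
  proof induction
    case base
    show ?case by (rule decision_diagram_decision_tree[OF assms(1)])
  next
    case (step D1 D2)
    then show ?case by (blast intro: bdd_step_decision_diagram)
  qed
qed

lemma ZDD_decision_diagram:
  assumes "finite E" "is_ZDD E S D"
  shows "decision_diagram E D"
proof -
  have "zdd_step\<^sup>*\<^sup>* (decision_tree E S) D" using assms(2) by (simp add: is_ZDD_def)
  then show ?thesis
  proof induction
    case base
    show ?case by (rule decision_diagram_decision_tree[OF assms(1)])
  next
    case (step D1 D2)
    then show ?case by (blast intro: zdd_step_decision_diagram)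
  qed
qed

end

theory Submission
  imports Defs
begin

text \<open>Every node of a reduced diagram, being a surviving node \<open>p\<close> of the decision tree, carries the
  cofactor of \<open>C\<close> at \<open>p\<close>. Distinct nodes of the ZDD carry distinct pairs of label and cofactor, and
  the 1-cofactor at such a node is nonempty. As \<open>C\<close> is a clutter, a member of the 1-cofactor cannot
  belong to the 0-cofactor, so the two cofactors differ, and a BDD must contain a node with this
  label and cofactor. Choosing such a node embeds the ZDD nodes into the BDD nodes.\<close>

section \<open>Cofactors, cylinders and node values\<close>

definition tail :: "'a::linorder set \<Rightarrow> nat \<Rightarrow> 'a set" where
  "tail E n = set (drop n (sorted_list_of_set E))"

definition cofactor :: "'a::linorder set \<Rightarrow> 'a set set \<Rightarrow> bool list \<Rightarrow> 'a set set" where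
  "cofactor E S p = {X. X \<subseteq> tail E (length p) \<and> chosen E p \<union> X \<in> S}"

text \<open>The cofactor as a Boolean function of all variables, so that removing a redundant BDD node
  does not change the value of the node above it.\<close>

definition cylinder :: "'a::linorder set \<Rightarrow> 'a set set \<Rightarrow> bool list \<Rightarrow> 'a set set" where
  "cylinder E S p = {X. X \<inter> tail E (length p) \<in> cofactor E S p}"

text \<open>The value of an inner node is read off the decision tree from its name \<open>p\<close>,
  not computed from the current diagram, so it survives every reduction. \<open>Top\<close> is
  \<open>{{}}\<close> because a variable skipped in a ZDD counts as absent; in
  \<open>bdd_value\<close> it is \<open>UNIV\<close> because a variable skipped in a BDD is
  free.\<close>

fun zdd_value :: "'a::linorder set \<Rightarrow> 'a set set \<Rightarrow> bool list node \<Rightarrow> 'a set set" where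
  "zdd_value E S Bot = {}"
| "zdd_value E S Top = {{}}"
| "zdd_value E S (Inner p) = cofactor E S p"

fun bdd_value :: "'a::linorder set \<Rightarrow> 'a set set \<Rightarrow> bool list node \<Rightarrow> 'a set set" where
  "bdd_value E S Bot = {}"
| "bdd_value E S Top = UNIV"
| "bdd_value E S (Inner p) = cylinder E S p"

section \<open>Shannon expansion along the decision tree\<close>

lemma drop_sorted_list_of_set:
  assumes "finite E" "n < card E"
  shows "drop n (sorted_list_of_set E) =
    sorted_list_of_set E ! n # drop (Suc n) (sorted_list_of_set E)"
  using assms by (intro Cons_nth_drop_Suc[symmetric]) simp

lemma tail_Suc:
  assumes "finite E" "n < card E"
  shows "tail E n = insert (sorted_list_of_set E ! n) (tail E (Suc n))"
  unfolding tail_def by (simp add: drop_sorted_list_of_set[OF assms])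

lemma nth_notin_tail_Suc:
  assumes "finite E" "n < card E"
  shows "sorted_list_of_set E ! n \<notin> tail E (Suc n)"
proof -
  have "distinct (drop n (sorted_list_of_set E))" by simp
  then show ?thesis
    unfolding tail_def drop_sorted_list_of_set[OF assms] distinct.simps by blast
qed

lemma nth_least_in_tail:
  assumes "finite E" "n < card E" "x \<in> tail E n"
  shows "sorted_list_of_set E ! n \<le> x"
proof -
  have "sorted (drop n (sorted_list_of_set E))" by (simp add: sorted_wrt_drop)
  then show ?thesis
    using assms(3) unfolding tail_def drop_sorted_list_of_set[OF assms(1,2)] by auto
qed

lemma tail_card: "finite E \<Longrightarrow> tail E (card E) = {}"
  by (simp add: tail_def)

lemma chosen_snoc:
  "chosen E (p @ [b]) = (if b then insert (sorted_list_of_set E ! length p) (chosen E p) else chosen E p)"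
proof -
  have image: "chosen E q = (!) (sorted_list_of_set E) ` {i. i < length q \<and> q ! i}" for q
    unfolding chosen_def by blast
  have "{i. i < length (p @ [b]) \<and> (p @ [b]) ! i} =
      (if b then insert (length p) {i. i < length p \<and> p ! i} else {i. i < length p \<and> p ! i})"
    by (auto simp: nth_append less_Suc_eq)
  then show ?thesis unfolding image by simp
qed

lemma nth_notin_chosen:
  assumes "finite E" "length p < card E"
  shows "sorted_list_of_set E ! length p \<notin> chosen E p"
  using assms by (auto simp: chosen_def nth_eq_iff_index_eq)

lemma cofactor_snoc_False:
  assumes "finite E" "length p < card E"
  shows "cofactor E S (p @ [False]) = {X \<in> cofactor E S p. sorted_list_of_set E ! length p \<notin> X}"
  using tail_Suc[OF assms] nth_notin_tail_Suc[OF assms]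
  by (auto simp: cofactor_def chosen_snoc)

lemma cofactor_snoc_True:
  assumes "finite E" "length p < card E"
  shows "cofactor E S (p @ [True]) =
    {X. sorted_list_of_set E ! length p \<notin> X \<and> insert (sorted_list_of_set E ! length p) X \<in> cofactor E S p}"
  using tail_Suc[OF assms] nth_notin_tail_Suc[OF assms]
  by (auto simp: cofactor_def chosen_snoc)

text \<open>Membership of a set is decided in one of the two branches, according to whether it
  contains the label. This justifies (NS) on the ZDD side; \<open>cylinder_eqI\<close> does so for
  BDDs.\<close>

lemma cofactor_eqI:
  assumes "finite E" "length p < card E" "length r = length p"
    and "cofactor E S (p @ [False]) = cofactor E S (r @ [False])"
    and "cofactor E S (p @ [True]) = cofactor E S (r @ [True])"
  shows "cofactor E S p = cofactor E S r"
proof -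
  let ?e = "sorted_list_of_set E ! length p"
  have "X \<in> cofactor E S q \<longleftrightarrow>
      (if ?e \<in> X then X - {?e} \<in> cofactor E S (q @ [True]) else X \<in> cofactor E S (q @ [False]))"
    if "length q = length p" for q X
    using that assms(1,2) by (auto simp: cofactor_snoc_False cofactor_snoc_True insert_absorb)
  then show ?thesis using assms(3-5) by (intro set_eqI) simp
qed

lemma cylinder_snoc:
  assumes "finite E" "length p < card E"
  shows "X \<in> cylinder E S p \<longleftrightarrow>
    X \<in> cylinder E S (p @ [sorted_list_of_set E ! length p \<in> X])"
proof (cases "sorted_list_of_set E ! length p \<in> X")
  case True
  then show ?thesis
    using tail_Suc[OF assms] nth_notin_tail_Suc[OF assms]
    by (simp add: cylinder_def cofactor_snoc_True[OF assms] Int_insert_right)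
next
  case False
  then show ?thesis
    using tail_Suc[OF assms]
    by (simp add: cylinder_def cofactor_snoc_False[OF assms] Int_insert_right)
qed

lemma cylinder_eqI:
  assumes "finite E" "length p < card E" "length r = length p"
    and "cylinder E S (p @ [False]) = cylinder E S (r @ [False])"
    and "cylinder E S (p @ [True]) = cylinder E S (r @ [True])"
  shows "cylinder E S p = cylinder E S r"
proof (rule set_eqI)
  fix X
  show "X \<in> cylinder E S p \<longleftrightarrow> X \<in> cylinder E S r"
    using cylinder_snoc[of E p X S] cylinder_snoc[of E r X S] assms
    by (cases "sorted_list_of_set E ! length p \<in> X") simp_all
qed

text \<open>A branch ignores the label of its parent, so membership of that label may first be
  forced to the value \<open>b\<close>; then the expansion at the parent applies.\<close>

lemma cylinder_snoc_cong:
  assumes "finite E" "length p < card E" "length q = length p" "cylinder E S q = cylinder E S p"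
  shows "cylinder E S (q @ [b]) = cylinder E S (p @ [b])"
proof -
  let ?e = "sorted_list_of_set E ! length p"
  have "X \<in> cylinder E S (r @ [b]) \<longleftrightarrow> (if b then insert ?e X else X - {?e}) \<in> cylinder E S r"
    if r: "length r = length p" for r X
  proof -
    have "X \<in> cylinder E S (r @ [b]) \<longleftrightarrow>
        (if b then insert ?e X else X - {?e}) \<in> cylinder E S (r @ [b])"
      using nth_notin_tail_Suc[OF assms(1,2)] r
      by (cases b) (simp_all add: cylinder_def Diff_Int_distrib2 Int_insert_left)
    also have "\<dots> \<longleftrightarrow> (if b then insert ?e X else X - {?e}) \<in> cylinder E S r"
      using cylinder_snoc[of E r "if b then insert ?e X else X - {?e}" S] assms(1,2) r
      by (cases b) simp_all
    finally show ?thesis .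
  qed
  then show ?thesis using assms(3,4) by (intro set_eqI) simp
qed

text \<open>At a fixed depth, cylinder and cofactor carry the same information; this is the passage
  from the BDD side back to the ZDD side.\<close>

lemma cofactor_eq_cylinder: "cofactor E S p = cylinder E S p \<inter> Pow (tail E (length p))"
  by (auto simp: cylinder_def cofactor_def Int_absorb2)

text \<open>If the cylinders agreed, a member \<open>X\<close> of the 1-cofactor would also lie in
  the 0-cofactor. Completing \<open>X\<close> with and without the label then gives two nested
  distinct members of \<open>S\<close>.\<close>

lemma clutter_cylinders_differ:
  assumes "finite E" "length p < card E" "clutter S" "cofactor E S (p @ [True]) \<noteq> {}"
  shows "cylinder E S (p @ [False]) \<noteq> cylinder E S (p @ [True])"
proof
  let ?e = "sorted_list_of_set E ! length p"
  assume eq: "cylinder E S (p @ [False]) = cylinder E S (p @ [True])"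
  obtain X where X: "X \<in> cofactor E S (p @ [True])" using assms(4) by blast
  then have "X \<in> cofactor E S (p @ [False])"
    using eq by (simp add: cofactor_eq_cylinder)
  then have "chosen E p \<union> X \<in> S" "insert ?e (chosen E p) \<union> X \<in> S"
    using X by (simp_all add: cofactor_def chosen_snoc)
  moreover have "chosen E p \<union> X \<subseteq> insert ?e (chosen E p) \<union> X" by blast
  ultimately have "chosen E p \<union> X = insert ?e (chosen E p) \<union> X"
    using assms(3) unfolding clutter_def by meson
  moreover have "?e \<notin> X" using X cofactor_snoc_True[OF assms(1,2)] by blast
  ultimately show False using nth_notin_chosen[OF assms(1,2)] by blast
qed

section \<open>Invariants of the reduction steps\<close>

lemma zdd_value_tree_node:
  assumes "finite E" "length p \<le> card E"
  shows "zdd_value E S (tree_node E S p) = cofactor E S p"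
  using assms by (auto simp: tree_node_def cofactor_def tail_card)

lemma bdd_value_tree_node:
  assumes "finite E" "length p \<le> card E"
  shows "bdd_value E S (tree_node E S p) = cylinder E S p"
  using assms by (auto simp: tree_node_def cylinder_def cofactor_def tail_card)

text \<open>\<open>T\<close> is the unreduced tree. Reductions may move the target of an arc, but
  only to a target of the same value.\<close>

definition faithful :: "('n node \<Rightarrow> 'b) \<Rightarrow> ('n, 'a) dd \<Rightarrow> ('n, 'a) dd \<Rightarrow> bool" where
  "faithful val T D \<longleftrightarrow> inner D \<subseteq> inner T \<and> lbl D = lbl T \<and>
     (\<forall>u\<in>inner D. val (lo D u) = val (lo T u) \<and> val (hi D u) = val (hi T u))"

lemma faithful_refl: "faithful val T T"
  by (simp add: faithful_def)

lemma faithful_remove_node: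
  assumes "faithful val T D" "val t = val (Inner v)"
  shows "faithful val T (remove_node v t D)"
proof -
  have "val (redirect v t x) = val x" for x using assms(2) by (simp add: redirect_def)
  then show ?thesis using assms(1) by (auto simp: faithful_def remove_node_def)
qed

lemma length_eq_if_label_eq:
  assumes "finite E" "p \<in> inner (decision_tree E S)" "r \<in> inner (decision_tree E S)"
    and "lbl (decision_tree E S) p = lbl (decision_tree E S) r"
  shows "length p = length r"
  using assms by (simp add: decision_tree_def nth_eq_iff_index_eq)

lemma faithful_zdd_values:
  assumes "finite E" "faithful (zdd_value E S) (decision_tree E S) D" "p \<in> inner D"
  shows "length p < card E" "zdd_value E S (lo D p) = cofactor E S (p @ [False])"
    "zdd_value E S (hi D p) = cofactor E S (p @ [True])"
proof -
  show "length p < card E" using assms(2,3) by (auto simp: faithful_def decision_tree_def)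
  then show "zdd_value E S (lo D p) = cofactor E S (p @ [False])"
    "zdd_value E S (hi D p) = cofactor E S (p @ [True])"
    using assms by (simp_all add: faithful_def decision_tree_def zdd_value_tree_node)
qed

lemma faithful_bdd_values:
  assumes "finite E" "faithful (bdd_value E S) (decision_tree E S) D" "p \<in> inner D"
  shows "length p < card E" "bdd_value E S (lo D p) = cylinder E S (p @ [False])"
    "bdd_value E S (hi D p) = cylinder E S (p @ [True])"
proof -
  show "length p < card E" using assms(2,3) by (auto simp: faithful_def decision_tree_def)
  then show "bdd_value E S (lo D p) = cylinder E S (p @ [False])"
    "bdd_value E S (hi D p) = cylinder E S (p @ [True])"
    using assms by (simp_all add: faithful_def decision_tree_def bdd_value_tree_node)
qed

lemma faithful_length_eq:
  assumes "finite E" "faithful val (decision_tree E S) D" "p \<in> inner D" "r \<in> inner D"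
    and "lbl D p = lbl D r"
  shows "length p = length r"
  using assms length_eq_if_label_eq[of E p S r] by (auto simp: faithful_def)

text \<open>A merge identifies nodes with equal cofactors. In a (Z-ND) step the 1-cofactor is empty,
  so the label occurs in no member and the 0-cofactor is the whole cofactor.\<close>

lemma zdd_step_faithful:
  assumes E: "finite E" and D: "faithful (zdd_value E S) (decision_tree E S) D"
    and "zdd_step D D'"
  shows "faithful (zdd_value E S) (decision_tree E S) D'"
  using assms(3) unfolding zdd_step_def
proof
  assume "ns_step D D'"
  then show ?thesis
  proof cases
    case (1 u v)
    have "length v = length u" using faithful_length_eq[OF E D 1(2,3,5)] by simp
    then have "cofactor E S u = cofactor E S v"
      using 1(6,7) faithful_zdd_values[OF E D 1(2)] faithful_zdd_values[OF E D 1(3)]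
      by (metis cofactor_eqI[OF E])
    then show ?thesis unfolding 1(1) by (intro faithful_remove_node[OF D]) simp
  qed
next
  assume "znd_step D D'"
  then show ?thesis
  proof cases
    case (1 v)
    note v = faithful_zdd_values[OF E D 1(2)]
    \<comment> \<open>For a set \<open>X\<close> containing the label this set is \<open>X\<close>
      itself, written in the form that the description of the 1-cofactor excludes.\<close>
    have "insert (sorted_list_of_set E ! length v) (X - {sorted_list_of_set E ! length v})
        \<notin> cofactor E S v" for X
      using v(3) 1 cofactor_snoc_True[OF E v(1)] by auto
    then have "sorted_list_of_set E ! length v \<notin> X" if "X \<in> cofactor E S v" for X
      using that by (metis insert_Diff)
    then have "zdd_value E S (lo D v) = cofactor E S v"
      using v(2) cofactor_snoc_False[OF E v(1)] by blast
    then show ?thesis unfolding 1(1) by (intro faithful_remove_node[OF D]) simp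
  qed
qed

text \<open>The lower bound on the BDD: every function in the tree that depends on the label of its
  own node keeps a representative at that depth.\<close>

definition bdd_covers :: "'a::linorder set \<Rightarrow> 'a set set \<Rightarrow> (bool list, 'a) dd \<Rightarrow> bool" where
  "bdd_covers E S D \<longleftrightarrow>
     (\<forall>p. length p < card E \<longrightarrow> cylinder E S (p @ [False]) \<noteq> cylinder E S (p @ [True]) \<longrightarrow>
        (\<exists>q\<in>inner D. length q = length p \<and> cylinder E S q = cylinder E S p))"

lemma bdd_covers_decision_tree: "bdd_covers E S (decision_tree E S)"
  by (auto simp: bdd_covers_def decision_tree_def)

text \<open>Both invariants are carried together, since faithfulness turns equal successors into
  equal cylinders. After a merge, \<open>u\<close> takes over as representative from
  \<open>v\<close>. A (B-ND) step deletes a node with equal branches, which represents no function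
  that has to be covered.\<close>

lemma bdd_step_invariants:
  assumes E: "finite E" and D: "faithful (bdd_value E S) (decision_tree E S) D"
    and cov: "bdd_covers E S D" and "bdd_step D D'"
  shows "faithful (bdd_value E S) (decision_tree E S) D' \<and> bdd_covers E S D'"
  using assms(4) unfolding bdd_step_def
proof
  assume "ns_step D D'"
  then show ?thesis
  proof cases
    case (1 u v)
    have len: "length v = length u" using faithful_length_eq[OF E D 1(2,3,5)] by simp
    then have eq: "cylinder E S u = cylinder E S v"
      using 1(6,7) faithful_bdd_values[OF E D 1(2)] faithful_bdd_values[OF E D 1(3)]
      by (metis cylinder_eqI[OF E])
    have "bdd_covers E S D'"
      unfolding bdd_covers_def
    proof (intro allI impI)
      fix p assume "length p < card E" "cylinder E S (p @ [False]) \<noteq> cylinder E S (p @ [True])"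
      then obtain q where "q \<in> inner D" "length q = length p" "cylinder E S q = cylinder E S p"
        using cov by (auto simp: bdd_covers_def)
      then show "\<exists>q\<in>inner D'. length q = length p \<and> cylinder E S q = cylinder E S p"
        using len eq 1 by (intro bexI[of _ "if q = v then u else q"]) (auto simp: remove_node_def)
    qed
    moreover have "faithful (bdd_value E S) (decision_tree E S) D'"
      unfolding 1(1) using eq by (intro faithful_remove_node[OF D]) simp
    ultimately show ?thesis by blast
  qed
next
  assume "bnd_step D D'"
  then show ?thesis
  proof cases
    case (1 v)
    note v = faithful_bdd_values[OF E D 1(2)]
    have eq: "cylinder E S (v @ [False]) = cylinder E S (v @ [True])"
      using v 1 by simp
    have "bdd_covers E S D'"
      unfolding bdd_covers_def
    proof (intro allI impI)
      fix p assume p: "length p < card E" "cylinder E S (p @ [False]) \<noteq> cylinder E S (p @ [True])"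
      then obtain q where q: "q \<in> inner D" "length q = length p" "cylinder E S q = cylinder E S p"
        using cov by (auto simp: bdd_covers_def)
      then have "q \<noteq> v" using cylinder_snoc_cong[OF E p(1)] p(2) eq by blast
      then show "\<exists>q\<in>inner D'. length q = length p \<and> cylinder E S q = cylinder E S p"
        using q 1 by (intro bexI[of _ q]) (auto simp: remove_node_def)
    qed
    moreover have "bdd_value E S (lo D v) = cylinder E S v"
    proof (rule set_eqI)
      fix X show "X \<in> bdd_value E S (lo D v) \<longleftrightarrow> X \<in> cylinder E S v"
        using v(2) eq cylinder_snoc[OF E v(1), of X S]
        by (cases "sorted_list_of_set E ! length v \<in> X") simp_all
    qed
    ultimately show ?thesis unfolding 1(1) by (auto intro: faithful_remove_node[OF D])
  qed
qed

section \<open>Distinct nodes of a ZDD have distinct values\<close>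

lemma ZDD_faithful:
  assumes "finite E" "is_ZDD E S Z"
  shows "faithful (zdd_value E S) (decision_tree E S) Z"
proof -
  have "zdd_step\<^sup>*\<^sup>* (decision_tree E S) Z" using assms(2) by (simp add: is_ZDD_def)
  then show ?thesis
    by induction (auto intro: faithful_refl zdd_step_faithful[OF assms(1)])
qed

lemma BDD_covers:
  assumes "finite E" "is_BDD E S B"
  shows "bdd_covers E S B"
proof -
  have "bdd_step\<^sup>*\<^sup>* (decision_tree E S) B" using assms(2) by (simp add: is_BDD_def)
  then have "faithful (bdd_value E S) (decision_tree E S) B \<and> bdd_covers E S B"
    by induction
      (auto simp: faithful_refl bdd_covers_decision_tree dest: bdd_step_invariants[OF assms(1)])
  then show ?thesis by blast
qed

lemma ZDD_reduced:
  assumes "is_ZDD E S Z"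
  shows "p \<in> inner Z \<Longrightarrow> hi Z p \<noteq> Bot"
    and "\<lbrakk>p \<in> inner Z; r \<in> inner Z; lbl Z p = lbl Z r; lo Z p = lo Z r; hi Z p = hi Z r\<rbrakk> \<Longrightarrow> p = r"
  using assms znd_step.intros[of p Z] ns_step.intros[of p Z r]
  unfolding is_ZDD_def zdd_step_def by blast+

text \<open>Adding the label to a member of the 1-cofactor gives a member of the cofactor, and all
  undecided elements are at least the label. Hence the cofactor alone determines the label.\<close>

lemma label_least_in_cofactor:
  assumes "finite E" "length p < card E" "cofactor E S (p @ [True]) \<noteq> {}"
  shows "sorted_list_of_set E ! length p \<in> \<Union>(cofactor E S p)"
    and "x \<in> \<Union>(cofactor E S p) \<Longrightarrow> sorted_list_of_set E ! length p \<le> x"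
  using assms(3) nth_least_in_tail[OF assms(1,2)]
  by (auto simp: cofactor_snoc_True[OF assms(1,2)]) (auto simp: cofactor_def)

text \<open>Terminals get depth \<open>n\<close>, taken to be \<open>card E\<close>, which places
  them below all inner nodes.\<close>

fun depth :: "nat \<Rightarrow> bool list node \<Rightarrow> nat" where
  "depth n (Inner p) = length p"
| "depth n _ = n"

lemma depth_less_if_label_before:
  assumes "finite E" "lbl D = lbl (decision_tree E S)" "p \<in> inner (decision_tree E S)"
    and "x \<in> {Bot, Top} \<union> Inner ` inner (decision_tree E S)" "label_before D p x"
  shows "length p < depth (card E) x"
proof (cases x)
  case (Inner r)
  then have "sorted_list_of_set E ! length p < sorted_list_of_set E ! length r"
    and "length p < card E"
    using assms by (auto simp: decision_tree_def)
  then have "\<not> length r \<le> length p"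
    using assms(1) sorted_nth_mono[of "sorted_list_of_set E" "length r" "length p"]
    by (auto simp: leD)
  then show ?thesis using Inner by simp
qed (use assms in \<open>auto simp: decision_tree_def\<close>)

text \<open>Induction from the terminals upwards, on the depth of the shallower of the two nodes.
  Equal values force equal labels and hence equal values of the successors; these coincide by
  induction, and (NS) then identifies the nodes.\<close>

lemma inj_on_zdd_value:
  assumes E: "finite E" and Z: "is_ZDD E S Z"
  shows "inj_on (zdd_value E S) ({Bot, Top} \<union> Inner ` inner Z)"
proof -
  let ?N = "{Bot, Top} \<union> Inner ` inner Z"
  note F = ZDD_faithful[OF E Z]
  note vals = faithful_zdd_values[OF E F]
  have dd: "decision_diagram E Z" by (rule ZDD_decision_diagram[OF E Z])
  have succ: "lo Z p \<in> ?N" "hi Z p \<in> ?N"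
      "length p < depth (card E) (lo Z p)" "length p < depth (card E) (hi Z p)"
    if "p \<in> inner Z" for p
  proof -
    show N: "lo Z p \<in> ?N" "hi Z p \<in> ?N" using dd that by (simp_all add: decision_diagram_iff)
    have "label_before Z p (lo Z p)" "label_before Z p (hi Z p)"
      using dd that by (simp_all add: decision_diagram_iff)
    then show "length p < depth (card E) (lo Z p)" "length p < depth (card E) (hi Z p)"
      using N F that by (auto simp: faithful_def intro!: depth_less_if_label_before[OF E])
  qed
  have "x = y"
    if "x \<in> ?N" "y \<in> ?N" "zdd_value E S x = zdd_value E S y"
    for x y
    using that
  proof (induction "card E - min (depth (card E) x) (depth (card E) y)"
      arbitrary: x y rule: less_induct)
    case less
    \<comment> \<open>With an empty 1-cofactor, \<open>hi Z p\<close> would have the value of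
      \<open>Bot\<close>. Both lie deeper than \<open>p\<close>, so the induction hypothesis would
      identify them, against (Z-ND).\<close>
    have hi_nonempty: "cofactor E S (p @ [True]) \<noteq> {}"
      if p: "p \<in> inner Z" and le: "min (depth (card E) x) (depth (card E) y) \<le> length p" for p
    proof
      assume "cofactor E S (p @ [True]) = {}"
      then have "zdd_value E S (hi Z p) = zdd_value E S Bot" using vals(3)[OF p] by simp
      moreover have "card E - min (depth (card E) (hi Z p)) (depth (card E) Bot)
          < card E - min (depth (card E) x) (depth (card E) y)"
        using le succ(4)[OF p] vals(1)[OF p] by auto
      ultimately have "hi Z p = Bot" using less.hyps[of "hi Z p" Bot] succ(2)[OF p] by blast
      then show False using ZDD_reduced(1)[OF Z p] by simp
    qed
    \<comment> \<open>The unordered pair covers both orders of \<open>x\<close> and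
      \<open>y\<close>.\<close>
    have inner_case: "Inner p = b"
      if p_in: "p \<in> inner Z" and b: "b \<in> ?N" and ab: "{Inner p, b} = {x, y}" for b p
    proof -
      have eq: "zdd_value E S (Inner p) = zdd_value E S b"
        using ab less.prems(3) by (metis doubleton_eq_iff)
      have min: "min (depth (card E) x) (depth (card E) y) = min (length p) (depth (card E) b)"
        using ab by (metis depth.simps(1) doubleton_eq_iff min.commute)
      have "cofactor E S (p @ [True]) \<noteq> {}" by (intro hi_nonempty p_in) (simp add: min)
      note p = label_least_in_cofactor[OF E vals(1)[OF p_in] this]
      show ?thesis
      proof (cases b)
        case (Inner r)
        then have r: "r \<in> inner Z" using b by auto
        have "cofactor E S (r @ [True]) \<noteq> {}" by (intro hi_nonempty r) (simp add: min Inner)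
        note r' = label_least_in_cofactor[OF E vals(1)[OF r] this]
        have cof: "cofactor E S p = cofactor E S r" using eq Inner by simp
        \<comment> \<open>Both labels are the least element of the union of the same
          cofactor.\<close>
        have "sorted_list_of_set E ! length p = sorted_list_of_set E ! length r"
          using p r' unfolding cof by (intro antisym)
        then have lbl: "lbl Z p = lbl Z r" using F by (simp add: faithful_def decision_tree_def)
        then have len: "length p = length r" using faithful_length_eq[OF E F p_in r] by simp
        have m: "min (depth (card E) x) (depth (card E) y) = length p"
          using min Inner len by simp
        have "zdd_value E S (lo Z p) = zdd_value E S (lo Z r)"
          "zdd_value E S (hi Z p) = zdd_value E S (hi Z r)"
          using vals[OF p_in] vals[OF r] len cof
          by (simp_all add: cofactor_snoc_False[OF E] cofactor_snoc_True[OF E])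
        moreover have "card E - min (depth (card E) a') (depth (card E) b')
            < card E - min (depth (card E) x) (depth (card E) y)"
          if "length p < depth (card E) a'" "length r < depth (card E) b'" for a' b'
          using that len m vals(1)[OF p_in] by (intro diff_less_mono2) simp_all
        ultimately have "lo Z p = lo Z r" "hi Z p = hi Z r"
          using less.hyps[OF _ succ(1)[OF p_in] succ(1)[OF r]]
            less.hyps[OF _ succ(2)[OF p_in] succ(2)[OF r]] succ(3,4)[OF p_in] succ(3,4)[OF r]
          by blast+
        then have "p = r" using ZDD_reduced(2)[OF Z p_in r lbl] by simp
        then show ?thesis using Inner by simp
      \<comment> \<open>For a terminal \<open>b\<close> the union of its value is empty, whereas the
        union of the cofactor at \<open>p\<close> contains the label.\<close>
      qed (use eq p(1) in auto)
    qed
    show ?case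
    proof (cases x)
      case (Inner p)
      then show ?thesis using inner_case[of p y] less.prems by auto
    next
      case Bot
      then show ?thesis using inner_case[of _ x] less.prems by (cases y) (auto simp: insert_commute)
    next
      case Top
      then show ?thesis using inner_case[of _ x] less.prems by (cases y) (auto simp: insert_commute)
    qed
  qed
  then show ?thesis by (rule inj_onI)
qed

section \<open>Embedding of the ZDD nodes into the BDD nodes\<close>

theorem theorem3p3:
  fixes E :: "'a::linorder set" and C :: "'a set set"
    and B Z :: "(bool list, 'a) dd"
  assumes "finite E" and "C \<subseteq> Pow E" and "clutter C"
    and "is_ZDD E C Z" and "is_BDD E C B"
  shows "dd_size Z \<le> dd_size B"
proof -
  note F = ZDD_faithful[OF assms(1,4)]
  note inj = inj_on_zdd_value[OF assms(1,4)]
  have "\<exists>q\<in>inner B. length q = length p \<and> cylinder E C q = cylinder E C p" if p: "p \<in> inner Z" for p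
  proof -
    note vals = faithful_zdd_values[OF assms(1) F p]
    have "hi Z p \<in> {Bot, Top} \<union> Inner ` inner Z"
      using ZDD_decision_diagram[OF assms(1,4)] p by (simp add: decision_diagram_iff)
    \<comment> \<open>(Z-ND) only says that \<open>hi Z p\<close> is not the node
      \<open>Bot\<close>; injectivity of the values turns this into a nonempty 1-cofactor.\<close>
    then have "zdd_value E C (hi Z p) \<noteq> zdd_value E C Bot"
      using inj ZDD_reduced(1)[OF assms(4) p] by (meson UnI1 inj_onD insertI1)
    then have "cofactor E C (p @ [True]) \<noteq> {}" using vals(3) by simp
    then show ?thesis
      using clutter_cylinders_differ[OF assms(1) vals(1) assms(3)] BDD_covers[OF assms(1,5)]
        vals(1)
      unfolding bdd_covers_def by blast
  qed
  then obtain f where f: "\<And>p. p \<in> inner Z \<Longrightarrow>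
      f p \<in> inner B \<and> length (f p) = length p \<and> cylinder E C (f p) = cylinder E C p"
    by metis
  \<comment> \<open>\<open>f p\<close> fixes depth and cylinder of \<open>p\<close>, hence its
    cofactor, hence \<open>p\<close> itself.\<close>
  have "inj_on f (inner Z)"
  proof (rule inj_onI)
    fix p r assume pr: "p \<in> inner Z" "r \<in> inner Z" "f p = f r"
    then have "cofactor E C p = cofactor E C r"
      using f[of p] f[of r] by (simp add: cofactor_eq_cylinder)
    then show "p = r" using inj_onD[OF inj, of "Inner p" "Inner r"] pr by simp
  qed
  moreover have "finite (inner B)"
    using BDD_decision_diagram[OF assms(1,5)] by (simp add: decision_diagram_iff)
  ultimately show ?thesis
    unfolding dd_size_def using f by (intro card_inj_on_le[of f]) auto
qed

end
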